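(* Let $G=\{1,\dots,n\}$ and let $\alpha=a_0<a_1<\dots<a_{p-1}<a_p=\beta$ be real numbers with $p\geqslant 1$. For every $\mathbf{x}=(x_1,\dots,x_n)\in[\alpha,\beta]^n$ there exist real coefficients $c_{E,r}(\mathbf{x})$, $E\subseteq G$, $r=0,1,\dots,p$, depending only on $\mathbf{x}$ and on the breakpoints $a_0,\dots,a_p$, such that for every piecewise linear level dependent capacity $\mu^L:2^G\times[\alpha,\beta]\to[0,1]$ relative to the breakpoints $a_0,\dots,a_p$, $$Ch^L(\mathbf{x},\mu^L)=\sum_{r=0}^{p}\sum_{E\subseteq G}c_{E,r}(\mathbf{x})\,\mu^L(E,a_r).$$ That is, the level dependent Choquet integral of $\mathbf{x}$ with respect to a piecewise linear level dependent capacity is a linear function of the values $\mu^L(E,a_0),\dots,\mu^L(E,a_p)$, $E\subseteq G$.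
   Context: $G=\{1,\dots,n\}$ is a finite set (of criteria). A capacity on $2^G$ is a set function $\mu:2^G\to[0,1]$ with $\mu(\emptyset)=0$, $\mu(G)=1$ and $\mu(B)\leqslant\mu(E)$ whenever $B\subseteq E\subseteq G$. A generalized (level dependent) capacity is a function $\mu^L:2^G\times[\alpha,\beta]\to[0,1]$ such that $\mu^L(\cdot,t)$ is a capacity on $2^G$ for every $t\in[\alpha,\beta]$, and, for every $E\subseteq G$, the function $t\mapsto\mu^L(E,t)$ is Lebesgue measurable. The level dependent Choquet integral of $\mathbf{x}=(x_1,\dots,x_n)\in[\alpha,\beta]^n$ with respect to $\mu^L$ is $$Ch^L(\mathbf{x},\mu^L)=\int_{\min\{x_1,\dots,x_n\}}^{\max\{x_1,\dots,x_n\}}\mu^L(\{i\in G:x_i\geqslant t\},t)\,dt+\min\{x_1,\dots,x_n\}.$$ A piecewise linear level dependent capacity relative to the breakpoints $\alpha=a_0<a_1<\dots<a_p=\beta$ is a function $\mu^L:2^G\times[\alpha,\beta]\to[0,1]$ such that $\mu^L(\cdot,a_0),\dots,\mu^L(\cdot,a_p)$ are capacities on $2^G$ and, for every $E\subseteq G$ and every $t\in[\alpha,\beta]\setminus\{a_0,\dots,a_p\}$, $$\mu^L(E,t)=\frac{a_{\underline{r}(t)+1}-t}{a_{\underline{r}(t)+1}-a_{\underline{r}(t)}}\,\mu^L(E,a_{\underline{r}(t)})+\frac{t-a_{\underline{r}(t)}}{a_{\underline{r}(t)+1}-a_{\underline{r}(t)}}\,\mu^L(E,a_{\underline{r}(t)+1}),$$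 where $\underline{r}(t)=\max\{r\in\{0,1,\dots,p\}:a_r<t\}$. Such a function is a generalized capacity. *)

theory Defs
  imports "HOL-Analysis.Analysis"
begin

text \<open>Set functions on \<open>2\<^sup>G\<close> are total functions of type \<open>'a set \<Rightarrow> real\<close>, constrained only on the
  subsets of \<open>G\<close>; level dependent ones take the level as second argument and are constrained only
  for levels in \<open>{\<alpha>..\<beta>}\<close>.\<close>

definition capacity :: "'a set \<Rightarrow> ('a set \<Rightarrow> real) \<Rightarrow> bool" where
  "capacity G \<mu> \<longleftrightarrow>
     (\<forall>E. E \<subseteq> G \<longrightarrow> \<mu> E \<in> {0..1}) \<and>
     \<mu> {} = 0 \<and> \<mu> G = 1 \<and>
     (\<forall>B E. B \<subseteq> E \<and> E \<subseteq> G \<longrightarrow> \<mu> B \<le> \<mu> E)"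

definition breakpoints :: "real \<Rightarrow> real \<Rightarrow> nat \<Rightarrow> (nat \<Rightarrow> real) \<Rightarrow> bool" where
  "breakpoints \<alpha> \<beta> p a \<longleftrightarrow> a 0 = \<alpha> \<and> a p = \<beta> \<and> strict_mono_on {0..p} a"

text \<open>The maximum is over a nonempty set only for \<open>t > a 0\<close>, which holds wherever it is used below.\<close>

definition lower_index :: "nat \<Rightarrow> (nat \<Rightarrow> real) \<Rightarrow> real \<Rightarrow> nat" where
  "lower_index p a t = Max {r \<in> {0..p}. a r < t}"

definition piecewise_linear_capacity ::
    "'a set \<Rightarrow> real \<Rightarrow> real \<Rightarrow> nat \<Rightarrow> (nat \<Rightarrow> real) \<Rightarrow> ('a set \<Rightarrow> real \<Rightarrow> real) \<Rightarrow> bool" where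
  "piecewise_linear_capacity G \<alpha> \<beta> p a \<mu> \<longleftrightarrow>
     (\<forall>E t. E \<subseteq> G \<and> t \<in> {\<alpha>..\<beta>} \<longrightarrow> \<mu> E t \<in> {0..1}) \<and>
     (\<forall>r\<in>{0..p}. capacity G (\<lambda>E. \<mu> E (a r))) \<and>
     (\<forall>E t. E \<subseteq> G \<and> t \<in> {\<alpha>..\<beta>} - a ` {0..p} \<longrightarrow>
        (let r = lower_index p a t in
          \<mu> E t = (a (r + 1) - t) / (a (r + 1) - a r) * \<mu> E (a r)
                 + (t - a r) / (a (r + 1) - a r) * \<mu> E (a (r + 1))))"

text \<open>Meaningful for finite nonempty \<open>G\<close>.\<close>

definition level_choquet :: "'a set \<Rightarrow> ('a \<Rightarrow> real) \<Rightarrow> ('a set \<Rightarrow> real \<Rightarrow> real) \<Rightarrow> real" where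
  "level_choquet G x \<mu> =
     (LINT t:{Min (x ` G)..Max (x ` G)}|lebesgue. \<mu> {i \<in> G. x i \<ge> t} t) + Min (x ` G)"

end

theory Submission
  imports Defs
begin

text \<open>
  On every cell between consecutive breakpoints, a piecewise linear capacity interpolates its values
  at the two ends of the cell.  Hence it is a combination of its breakpoint values whose weights are
  the hat functions \<open>hat p a r\<close> of the subdivision: these do not depend on the capacity, nor on the
  coalition \<open>E\<close> (\<open>piecewise_linear_capacity_hat\<close>).

  For fixed \<open>x\<close> the coalition \<open>{i \<in> G. x i \<ge> t}\<close> is a function of \<open>t\<close> with finitely many values \<open>E\<close>.
  Splitting the integrand of the Choquet integral along these values and along the hat functions
  gives a finite sum of integrals, in each of which the number \<open>\<mu> E (a r)\<close> is a constant factor;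
  what is left is the coefficient of \<open>\<mu> E (a r)\<close>.  The additive term \<open>Min (x ` G)\<close> becomes linear in
  the capacity because \<open>\<mu> G (a 0) = 1\<close>: it is added to the coefficient of \<open>\<mu> G (a 0)\<close>.
\<close>

text \<open>At the two outer breakpoints one slope of the hat function is missing, hence the guards
  \<open>0 < r\<close> and \<open>r < p\<close>.\<close>

definition hat :: "nat \<Rightarrow> (nat \<Rightarrow> real) \<Rightarrow> nat \<Rightarrow> real \<Rightarrow> real" where
  "hat p a r t =
     (if 0 < r \<and> a (r - 1) \<le> t \<and> t \<le> a r then (t - a (r - 1)) / (a r - a (r - 1))
      else if r < p \<and> a r \<le> t \<and> t \<le> a (r + 1) then (a (r + 1) - t) / (a (r + 1) - a r)
      else 0)"

lemma hat_measurable [measurable]: "hat p a r \<in> borel_measurable borel"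
  unfolding hat_def by measurable

lemma abs_hat_le_1: "\<bar>hat p a r t\<bar> \<le> 1"
  by (auto simp: hat_def divide_le_eq)

lemma hat_interpolation:
  fixes f :: "nat \<Rightarrow> real"
  assumes a: "strict_mono_on {0..p} a" and s: "s < p" and t: "a s \<le> t" "t \<le> a (s + 1)"
  shows "(\<Sum>r=0..p. hat p a r t * f r) =
    (a (s + 1) - t) / (a (s + 1) - a s) * f s + (t - a s) / (a (s + 1) - a s) * f (s + 1)"
proof -
  have less: "a i < a j" if "i < j" "j \<le> p" for i j
    using strict_mono_onD[OF a] that by auto
  have le: "a i \<le> a j" if "i \<le> j" "j \<le> p" for i j
    using less[of i j] that by (cases "i = j") auto
  have zero: "hat p a r t = 0" if r: "r \<le> p" "r \<noteq> s" "r \<noteq> s + 1" for r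
  proof (cases "r < s")
    case True
    \<comment> \<open>At the common endpoint of adjacent cells the descending branch is active, with value 0.\<close>
    then show ?thesis
      using less[of r s] le[of "r + 1" s] s t by (auto simp: hat_def)
  next
    case False
    then have "t < a r" "t \<le> a (r - 1)"
      using less[of "s + 1" r] le[of "s + 1" "r - 1"] r t by linarith+
    then show ?thesis by (auto simp: hat_def)
  qed
  have hat_s: "hat p a s t = (a (s + 1) - t) / (a (s + 1) - a s)"
  proof (cases "t = a s")
    case True
    then show ?thesis
      using less[of "s - 1" s] less[of s "s + 1"] s by (cases "s = 0") (auto simp: hat_def)
  next
    case False
    then show ?thesis using s t by (auto simp: hat_def)
  qed
  have hat_Suc: "hat p a (s + 1) t = (t - a s) / (a (s + 1) - a s)"
    using t by (auto simp: hat_def)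
  have "(\<Sum>r=0..p. hat p a r t * f r) = (\<Sum>r\<in>{s, s + 1}. hat p a r t * f r)"
    using s zero by (intro sum.mono_neutral_right) auto
  then show ?thesis
    using hat_s hat_Suc by simp
qed

lemma lower_index_eq:
  assumes a: "strict_mono_on {0..p} a" and s: "s < p" and t: "a s < t" "t < a (s + 1)"
  shows "lower_index p a t = s"
  unfolding lower_index_def
proof (rule Max_eqI)
  show "r \<le> s" if r: "r \<in> {r \<in> {0..p}. a r < t}" for r
  proof (rule ccontr)
    assume "\<not> r \<le> s"
    then have "a (s + 1) \<le> a r"
      using strict_mono_onD[OF a, of "s + 1" r] r by (cases "r = s + 1") auto
    then show False using r t by simp
  qed
qed (use s t in auto)

lemma cell_exists:
  fixes a :: "nat \<Rightarrow> real"
  assumes "0 < p" "a 0 \<le> t" "t \<le> a p"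
  shows "\<exists>s<p. a s \<le> t \<and> t \<le> a (s + 1)"
  using assms
proof (induction p)
  case (Suc p)
  show ?case
  proof (cases "p = 0 \<or> a p \<le> t")
    case True
    then show ?thesis using Suc.prems by auto
  next
    case False
    then show ?thesis using Suc by (auto intro: less_SucI)
  qed
qed simp

text \<open>The interpolation formula is only assumed off the breakpoints; at a breakpoint it holds too,
  because one of its two weights is 1 and the other 0.\<close>

lemma piecewise_linear_capacity_hat:
  assumes mu: "piecewise_linear_capacity G \<alpha> \<beta> p a \<mu>" and bp: "breakpoints \<alpha> \<beta> p a"
    and p: "0 < p" and E: "E \<subseteq> G" and t: "t \<in> {\<alpha>..\<beta>}"
  shows "\<mu> E t = (\<Sum>r=0..p. hat p a r t * \<mu> E (a r))"
proof -
  have a: "strict_mono_on {0..p} a" and ends: "a 0 = \<alpha>" "a p = \<beta>"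
    using bp by (auto simp: breakpoints_def)
  obtain s where s: "s < p" "a s \<le> t" "t \<le> a (s + 1)"
    using cell_exists[OF p, of a t] t ends by auto
  have less: "a i < a j" if "i < j" "j \<le> p" for i j
    using strict_mono_onD[OF a] that by auto
  have "\<mu> E t = (a (s + 1) - t) / (a (s + 1) - a s) * \<mu> E (a s)
              + (t - a s) / (a (s + 1) - a s) * \<mu> E (a (s + 1))"
  proof (cases "t = a s \<or> t = a (s + 1)")
    case True
    then show ?thesis using less[of s "s + 1"] s by auto
  next
    case False
    then have t': "a s < t" "t < a (s + 1)" using s by auto
    have idx: "lower_index p a t = s"
      by (rule lower_index_eq[OF a s(1) t'])
    have off: "t \<noteq> a r" if r: "r \<le> p" for r
    proof (cases "r \<le> s")
      case True
      then have "a r \<le> a s" using less[of r s] s by (cases "r = s") auto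
      then show ?thesis using t' by simp
    next
      case False
      then have "a (s + 1) \<le> a r" using less[of "s + 1" r] r by (cases "r = s + 1") auto
      then show ?thesis using t' by simp
    qed
    have "t \<in> {\<alpha>..\<beta>} - a ` {0..p}" using t off by (metis DiffI atLeastAtMost_iff imageE)
    then show ?thesis
      using mu E idx unfolding piecewise_linear_capacity_def Let_def by metis
  qed
  then show ?thesis using hat_interpolation[OF a s] by simp
qed

definition choquet_weight ::
    "nat \<Rightarrow> (nat \<Rightarrow> real) \<Rightarrow> 'a set \<Rightarrow> ('a \<Rightarrow> real) \<Rightarrow> 'a set \<Rightarrow> nat \<Rightarrow> real \<Rightarrow> real" where
  "choquet_weight p a G x E r t = (if {i \<in> G. x i \<ge> t} = E then hat p a r t else 0)"

text \<open>The weight is bounded by 1, and it is measurable in the level because the coalition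
  \<open>{i \<in> G. x i \<ge> t}\<close> equals \<open>E\<close> exactly if \<open>t\<close> satisfies one threshold condition for each of the
  finitely many elements of \<open>G\<close>.\<close>

lemma choquet_weight_set_integrable:
  assumes "finite G" "E \<subseteq> G"
  shows "set_integrable lebesgue {l..u} (choquet_weight p a G x E r)"
proof -
  have eq: "choquet_weight p a G x E r =
      (\<lambda>t. if \<forall>i\<in>G. (x i \<ge> t) = (i \<in> E) then hat p a r t else 0)"
    using assms(2) by (auto simp: choquet_weight_def fun_eq_iff)
  have "choquet_weight p a G x E r \<in> borel_measurable borel"
    unfolding eq using assms(1) by measurable
  then have meas: "choquet_weight p a G x E r \<in> borel_measurable lebesgue"
    by (auto intro: measurable_completion)
  show ?thesis
  proof (rule set_integrable_bound[where f = "\<lambda>t. 1::real"])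
    show "set_integrable lebesgue {l..u} (\<lambda>t. 1::real)"
      by (simp add: set_integrable_def integrable_indicator_iff emeasure_lborel_Icc_eq)
    show "set_borel_measurable lebesgue {l..u} (choquet_weight p a G x E r)"
      unfolding set_borel_measurable_def
      by (intro borel_measurable_scaleR borel_measurable_indicator meas) auto
    show "AE t in lebesgue. t \<in> {l..u} \<longrightarrow> norm (choquet_weight p a G x E r t) \<le> norm (1::real)"
      using abs_hat_le_1 by (auto simp: choquet_weight_def)
  qed
qed

theorem level_choquet_linear:
  assumes G: "finite G" "G \<noteq> {}" and bp: "breakpoints \<alpha> \<beta> p a" and p: "0 < p"
    and x: "\<And>i. i \<in> G \<Longrightarrow> x i \<in> {\<alpha>..\<beta>}"
    and mu: "piecewise_linear_capacity G \<alpha> \<beta> p a \<mu>"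
  shows "level_choquet G x \<mu> =
    (\<Sum>r=0..p. \<Sum>E\<in>Pow G.
       ((LINT t:{Min (x ` G)..Max (x ` G)}|lebesgue. choquet_weight p a G x E r t)
        + (if E = G \<and> r = 0 then Min (x ` G) else 0)) * \<mu> E (a r))"
proof -
  let ?I = "{Min (x ` G)..Max (x ` G)}"
  let ?w = "choquet_weight p a G x"
  have I: "?I \<subseteq> {\<alpha>..\<beta>}"
  proof -
    have "Min (x ` G) \<in> x ` G" "Max (x ` G) \<in> x ` G" using G by auto
    then show ?thesis using x by fastforce
  qed
  have split: "\<mu> {i \<in> G. x i \<ge> t} t = (\<Sum>r=0..p. \<Sum>E\<in>Pow G. ?w E r t * \<mu> E (a r))"
    if "t \<in> ?I" for t
  proof -
    let ?E = "{i \<in> G. x i \<ge> t}"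
    have "\<mu> ?E t = (\<Sum>r=0..p. hat p a r t * \<mu> ?E (a r))"
      by (rule piecewise_linear_capacity_hat[OF mu bp p]) (use that I in auto)
    also have "\<dots> = (\<Sum>r=0..p. \<Sum>E\<in>Pow G. if ?E = E then hat p a r t * \<mu> E (a r) else 0)"
      using G by (intro sum.cong refl) (auto simp: sum.delta')
    also have "\<dots> = (\<Sum>r=0..p. \<Sum>E\<in>Pow G. ?w E r t * \<mu> E (a r))"
      by (intro sum.cong refl) (auto simp: choquet_weight_def)
    finally show ?thesis .
  qed
  have int: "set_integrable lebesgue ?I (\<lambda>t. ?w E r t * \<mu> E (a r))" if "E \<in> Pow G" for E r
    using choquet_weight_set_integrable[OF G(1)] that by auto
  have "(LINT t:?I|lebesgue. \<mu> {i \<in> G. x i \<ge> t} t)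
      = (LINT t:?I|lebesgue. \<Sum>r=0..p. \<Sum>E\<in>Pow G. ?w E r t * \<mu> E (a r))"
    by (intro set_lebesgue_integral_cong) (auto simp: split)
  also have "\<dots> = (\<Sum>r=0..p. \<Sum>E\<in>Pow G. LINT t:?I|lebesgue. ?w E r t * \<mu> E (a r))"
    unfolding set_lebesgue_integral_def scaleR_sum_right
    by (subst Bochner_Integration.integral_sum;
        intro sum.cong refl Bochner_Integration.integral_sum Bochner_Integration.integrable_sum
          int[unfolded set_integrable_def])
  also have "\<dots> = (\<Sum>r=0..p. \<Sum>E\<in>Pow G. (LINT t:?I|lebesgue. ?w E r t) * \<mu> E (a r))"
    by simp
  finally have integral: "(LINT t:?I|lebesgue. \<mu> {i \<in> G. x i \<ge> t} t) = \<dots>" .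
  have "\<mu> G (a 0) = 1"
    using mu by (auto simp: piecewise_linear_capacity_def capacity_def)
  then have "Min (x ` G) = (\<Sum>r=0..p. if r = 0 then Min (x ` G) * \<mu> G (a r) else 0)"
    by simp
  also have "\<dots> = (\<Sum>r=0..p. \<Sum>E\<in>Pow G.
      if E = G then if r = 0 then Min (x ` G) * \<mu> E (a r) else 0 else 0)"
    using G by simp
  also have "\<dots> = (\<Sum>r=0..p. \<Sum>E\<in>Pow G.
      (if E = G \<and> r = 0 then Min (x ` G) else 0) * \<mu> E (a r))"
    by (intro sum.cong refl) auto
  finally show ?thesis
    unfolding level_choquet_def integral
    by (simp add: distrib_right sum.distrib)
qed

theorem mainTheorem1:
  fixes n p :: nat and \<alpha> \<beta> :: real and a :: "nat \<Rightarrow> real" and x :: "nat \<Rightarrow> real"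
  assumes "n \<ge> 1" and "p \<ge> 1"
    and "breakpoints \<alpha> \<beta> p a"
    and "\<forall>i\<in>{1..n}. x i \<in> {\<alpha>..\<beta>}"
  shows "\<exists>c :: nat set \<Rightarrow> nat \<Rightarrow> real.
           \<forall>\<mu> :: nat set \<Rightarrow> real \<Rightarrow> real.
             piecewise_linear_capacity {1..n} \<alpha> \<beta> p a \<mu> \<longrightarrow>
             level_choquet {1..n} x \<mu> = (\<Sum>r=0..p. \<Sum>E\<in>Pow {1..n}. c E r * \<mu> E (a r))"
proof -
  let ?G = "{1..n}"
  let ?c = "\<lambda>E r. (LINT t:{Min (x ` ?G)..Max (x ` ?G)}|lebesgue. choquet_weight p a ?G x E r t)
                  + (if E = ?G \<and> r = 0 then Min (x ` ?G) else 0)"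
  have "level_choquet ?G x \<mu> = (\<Sum>r=0..p. \<Sum>E\<in>Pow ?G. ?c E r * \<mu> E (a r))"
    if "piecewise_linear_capacity ?G \<alpha> \<beta> p a \<mu>" for \<mu> :: "nat set \<Rightarrow> real \<Rightarrow> real"
    using assms that by (intro level_choquet_linear) auto
  then show ?thesis by (intro exI[of _ ?c]) blast
qed

end
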